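(* For each positive integer $n$ let $E_n:\{-n,\dots,n\}\to\mathbb{R}$ be the kernel $$E_n(k)=\frac{3}{n(4n^2-1)}\left(n^2-k^2\right),$$ and let $$\mu=\max_{\alpha\in[0,16]}\left|\frac{\sin\alpha}{\alpha}-\cos\alpha\right|.$$ Then, as $n\to\infty$, $$\sup_{0\neq f\in\ell^2(\mathbb{Z})}\frac{\|\Delta(E_n\ast f)\|_{\ell^2(\mathbb{Z})}}{\|f\|_{\ell^2(\mathbb{Z})}}\;\sim\;\frac{3\mu}{\pi}\cdot\frac{\pi}{n^2}.$$
   Context: Functions $f$ range over real-valued square-summable $f:\mathbb{Z}\to\mathbb{R}$. For $u:\{-n,\dots,n\}\to\mathbb{R}$, the convolution is $(u\ast f)(k)=\sum_{\ell=-n}^{n}u(\ell)f(k-\ell)$ for $k\in\mathbb{Z}$. The discrete Laplacian is $(\Delta f)(k)=f(k+2)-2f(k+1)+f(k)$. At $\alpha=0$ the expression $\frac{\sin\alpha}{\alpha}$ is interpreted as $1$. The notation $a_n\sim b_n$ means $a_n/b_n\to1$ as $n\to\infty$. *)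

theory Defs
  imports
    "HOL-Probability.Sinc_Integral"
    "HOL-Library.Landau_Symbols"
begin

unbundle asymp_equiv_syntax

definition ell2 :: "(int \<Rightarrow> real) set" where
  "ell2 = {f. (\<lambda>k. (f k)\<^sup>2) summable_on UNIV}"

definition ell2_norm :: "(int \<Rightarrow> real) \<Rightarrow> real" where
  "ell2_norm f = sqrt (\<Sum>\<^sub>\<infinity>k. (f k)\<^sup>2)"

(* A kernel {-n..n} \<rightarrow> R is a function on int; its values outside {-n..n} are never used. *)
definition convolve :: "nat \<Rightarrow> (int \<Rightarrow> real) \<Rightarrow> (int \<Rightarrow> real) \<Rightarrow> int \<Rightarrow> real" where
  "convolve n u f = (\<lambda>k. \<Sum>l = - int n..int n. u l * f (k - l))"

definition laplacian :: "(int \<Rightarrow> real) \<Rightarrow> int \<Rightarrow> real" where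
  "laplacian f = (\<lambda>k. f (k + 2) - 2 * f (k + 1) + f k)"

definition E :: "nat \<Rightarrow> int \<Rightarrow> real" where
  "E n k = 3 / (real n * (4 * (real n)\<^sup>2 - 1)) * ((real n)\<^sup>2 - (real_of_int k)\<^sup>2)"

(* Max only covers finite sets, so the maximum is taken as the greatest element of the image. *)
definition mu :: real where
  "mu = (GREATEST y. y \<in> (\<lambda>\<alpha>. \<bar>sinc \<alpha> - cos \<alpha>\<bar>) ` {0..16})"

lemma mu_is_maximum:
  "mu \<in> (\<lambda>\<alpha>. \<bar>sinc \<alpha> - cos \<alpha>\<bar>) ` {0..16}"
  "\<alpha> \<in> {0..16} \<Longrightarrow> \<bar>sinc \<alpha> - cos \<alpha>\<bar> \<le> mu"
proof -
  let ?g = "\<lambda>\<alpha>::real. \<bar>sinc \<alpha> - cos \<alpha>\<bar>"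
  have "continuous_on {0..16} ?g"
    by (intro continuous_intros continuous_on_sinc)
  then obtain a where a: "a \<in> {0..16}" "\<And>x. x \<in> {0..16} \<Longrightarrow> ?g x \<le> ?g a"
    using continuous_attains_sup[of "{0..16::real}" ?g] by auto
  have "mu = ?g a"
    unfolding mu_def
  proof (rule Greatest_equality)
    show "?g a \<in> ?g ` {0..16}" using a(1) by (rule imageI)
    show "y \<le> ?g a" if "y \<in> ?g ` {0..16}" for y using that a(2) by blast
  qed
  then show "mu \<in> ?g ` {0..16}" "\<alpha> \<in> {0..16} \<Longrightarrow> ?g \<alpha> \<le> mu"
    using imageI[OF a(1), of ?g] a(2)[of \<alpha>] by (simp_all only:)
qed

(* The supremum of the ratios is a genuine real supremum: the facts below show that it is taken
   over a nonempty set that is bounded above, and that all norms involved are finite. *)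

lemma finite_filter_bounded:
  fixes I :: "'i set" and c :: "'i \<Rightarrow> real" and s :: "'i \<Rightarrow> int"
  assumes f: "f \<in> ell2"
  defines "g \<equiv> (\<lambda>k. \<Sum>i\<in>I. c i * f (k + s i))"
  shows "g \<in> ell2"
    and "ell2_norm g \<le> sqrt (real (card I) * (\<Sum>i\<in>I. (c i)\<^sup>2)) * ell2_norm f"
proof -
  have bij: "bij_betw (\<lambda>k. k + s i) UNIV UNIV" for i
    by (rule bij_betw_byWitness[where f' = "\<lambda>k. k - s i"]) auto
  let ?F = "\<Sum>\<^sub>\<infinity>k. (f k)\<^sup>2"
  have "((\<lambda>k. (f k)\<^sup>2) has_sum ?F) UNIV"
    using f by (simp add: ell2_def has_sum_infsum)
  then have shifted: "((\<lambda>k. (f (k + s i))\<^sup>2) has_sum ?F) UNIV" for i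
    using has_sum_reindex_bij_betw[OF bij, of "\<lambda>k. (f k)\<^sup>2"] by simp
  have weighted: "((\<lambda>k. \<Sum>i\<in>J. (c i)\<^sup>2 * (f (k + s i))\<^sup>2) has_sum (\<Sum>i\<in>J. (c i)\<^sup>2 * ?F)) UNIV" for J
    by (induction J rule: infinite_finite_induct)
       (simp_all add: has_sum_add has_sum_cmult_right shifted)
  define h where "h = (\<lambda>k. real (card I) * (\<Sum>i\<in>I. (c i)\<^sup>2 * (f (k + s i))\<^sup>2))"
  have h: "(h has_sum real (card I) * (\<Sum>i\<in>I. (c i)\<^sup>2 * ?F)) UNIV"
    unfolding h_def by (intro has_sum_cmult_right weighted)
  have le: "(g k)\<^sup>2 \<le> h k" for k
    using sum_squared_le_sum_of_squares[of "\<lambda>i. c i * f (k + s i)" I]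
    by (simp add: g_def h_def power_mult_distrib mult.commute)
  have g: "(\<lambda>k. (g k)\<^sup>2) summable_on UNIV"
    by (rule summable_on_comparison_test[OF has_sum_imp_summable[OF h]]) (use le in auto)
  then show "g \<in> ell2" by (simp add: ell2_def)
  have "(\<Sum>\<^sub>\<infinity>k. (g k)\<^sup>2) \<le> real (card I) * (\<Sum>i\<in>I. (c i)\<^sup>2 * ?F)"
    by (rule has_sum_mono[OF has_sum_infsum[OF g] h]) (rule le)
  also have "\<dots> = real (card I) * (\<Sum>i\<in>I. (c i)\<^sup>2) * ?F"
    by (simp add: sum_distrib_right mult.assoc)
  finally show "ell2_norm g \<le> sqrt (real (card I) * (\<Sum>i\<in>I. (c i)\<^sup>2)) * ell2_norm f"
    unfolding ell2_norm_def real_sqrt_mult[symmetric] by (rule real_sqrt_le_mono)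
qed

lemma convolve_bounded:
  "\<exists>C\<ge>0. \<forall>f\<in>ell2. convolve n u f \<in> ell2 \<and> ell2_norm (convolve n u f) \<le> C * ell2_norm f"
proof -
  define I where "I = {- int n..int n}"
  have eq: "convolve n u f = (\<lambda>k. \<Sum>l\<in>I. u l * f (k + - l))" for f
    by (simp add: convolve_def I_def)
  have "0 \<le> sqrt (real (card I) * (\<Sum>l\<in>I. (u l)\<^sup>2))"
    by (simp add: sum_nonneg)
  then show ?thesis
    unfolding eq using finite_filter_bounded[where I = I and c = u and s = uminus] by blast
qed

lemma laplacian_bounded:
  "\<exists>C\<ge>0. \<forall>f\<in>ell2. laplacian f \<in> ell2 \<and> ell2_norm (laplacian f) \<le> C * ell2_norm f"
proof -
  define I :: "int set" where "I = {0, 1, 2}"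
  define c :: "int \<Rightarrow> real" where "c i = (if i = 1 then - 2 else 1)" for i
  have eq: "laplacian f = (\<lambda>k. \<Sum>i\<in>I. c i * f (k + i))" for f
    by (simp add: laplacian_def c_def I_def fun_eq_iff)
  have "0 \<le> sqrt (real (card I) * (\<Sum>i\<in>I. (c i)\<^sup>2))"
    by (simp add: sum_nonneg)
  then show ?thesis
    unfolding eq using finite_filter_bounded[where I = I and c = c and s = "\<lambda>i. i"] by blast
qed

lemma ell2_norm_pos:
  assumes "f \<in> ell2" "f \<noteq> (\<lambda>_. 0)"
  shows "ell2_norm f > 0"
proof -
  obtain k where k: "f k \<noteq> 0" using assms(2) by auto
  have "(\<Sum>\<^sub>\<infinity>j\<in>{k}. (f j)\<^sup>2) \<le> (\<Sum>\<^sub>\<infinity>j. (f j)\<^sup>2)"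
    by (rule infsum_mono2) (use assms(1) in \<open>auto simp: ell2_def\<close>)
  then have "(f k)\<^sup>2 \<le> (\<Sum>\<^sub>\<infinity>j. (f j)\<^sup>2)" by simp
  moreover have "(f k)\<^sup>2 > 0" using k by simp
  ultimately have "(\<Sum>\<^sub>\<infinity>j. (f j)\<^sup>2) > 0" by (rule less_le_trans[rotated])
  then show ?thesis by (simp add: ell2_norm_def)
qed

lemma ratios_nonempty: "ell2 - {\<lambda>_. 0} \<noteq> {}"
proof -
  let ?d = "\<lambda>k::int. if k = 0 then 1 else 0 :: real"
  have "(\<lambda>k. (?d k)\<^sup>2) summable_on UNIV"
    by (rule finite_nonzero_values_imp_summable_on) simp
  then have "?d \<in> ell2" by (simp add: ell2_def)
  moreover have "?d \<noteq> (\<lambda>_. 0)" by (metis zero_neq_one)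
  ultimately show ?thesis by blast
qed

lemma ratios_bdd_above:
  "bdd_above ((\<lambda>f. ell2_norm (laplacian (convolve n u f)) / ell2_norm f) ` (ell2 - {\<lambda>_. 0}))"
proof -
  obtain C where C: "C \<ge> 0" "\<And>f. f \<in> ell2 \<Longrightarrow> convolve n u f \<in> ell2"
      "\<And>f. f \<in> ell2 \<Longrightarrow> ell2_norm (convolve n u f) \<le> C * ell2_norm f"
    using convolve_bounded[of n u] by blast
  obtain D where D: "D \<ge> 0"
      "\<And>f. f \<in> ell2 \<Longrightarrow> ell2_norm (laplacian f) \<le> D * ell2_norm f"
    using laplacian_bounded by blast
  show ?thesis
  proof (rule bdd_aboveI2)
    fix f assume f: "f \<in> ell2 - {\<lambda>_. 0}"
    then have "ell2_norm (laplacian (convolve n u f)) \<le> D * ell2_norm (convolve n u f)"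
      using C(2) D(2) by blast
    also have "\<dots> \<le> D * (C * ell2_norm f)"
      using f C(3) D(1) by (intro mult_left_mono) auto
    finally show "ell2_norm (laplacian (convolve n u f)) / ell2_norm f \<le> D * C"
      using ell2_norm_pos[of f] f by (simp add: divide_le_eq mult.assoc)
  qed
qed

end

theory Submission
  imports Defs "HOL-Real_Asymp.Real_Asymp"
begin

text \<open>A finite filter on square-summable sequences has norm equal to the maximum modulus of its
  symbol: Parseval gives the upper bound, truncated plane waves the lower one. With
  \<open>\<alpha> = n \<theta>\<close> and \<open>t = \<theta>/2 cot (\<theta>/2) \<in> [0, 1]\<close>, the symbol of the filter \<open>f \<mapsto> \<Delta> (E\<^sub>n * f)\<close> has
  modulus exactly \<open>12 / (4 n\<^sup>2 - 1) \<bar>t sinc \<alpha> - cos \<alpha>\<bar>\<close>. By convexity and \<open>mu \<ge> 1\<close> this is at most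
  \<open>12 mu / (4 n\<^sup>2 - 1)\<close>; for the \<open>\<alpha>\<close> attaining \<open>mu\<close>, kept fixed, \<open>t \<rightarrow> 1\<close> gives the matching lower
  bound.\<close>

section \<open>Finite filters and their symbols\<close>

lemma sum_int_interval:
  fixes g :: "int \<Rightarrow> 'a::comm_monoid_add"
  shows "(\<Sum>j = - int K..int K. g j) = (\<Sum>i<2 * K + 1. g (int i - int K))"
  by (rule sum.reindex_bij_witness[where i = "\<lambda>i. int i - int K" and j = "\<lambda>j. nat (j + int K)"]) auto

lemma sum_int_interval_Suc:
  fixes g :: "int \<Rightarrow> 'a::comm_monoid_add"
  shows "(\<Sum>j = - int (Suc n)..int (Suc n). g j) =
    (\<Sum>j = - int n..int n. g j) + (g (int (Suc n)) + g (- int (Suc n)))"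
proof -
  have "{- int (Suc n)..int (Suc n)} = insert (int (Suc n)) (insert (- int (Suc n)) {- int n..int n})"
    by auto
  then show ?thesis by (simp add: ac_simps)
qed

text \<open>With \<open>x\<close> = 2 \<pi> m / (2K+1), this is a geometric sum with ratio
  \<open>cis x\<close>, whose (2K+1)-st power is 1. The ratio itself is 1 only if 2K+1 divides m,
  and |m| \<le> 2K leaves m = 0 as the only such case.\<close>

lemma sum_cis_orthogonal:
  fixes m :: int
  assumes "\<bar>m\<bar> \<le> 2 * int K"
  shows "(\<Sum>j = - int K..int K. cis (of_int m * (2 * pi * of_int j / (2 * real K + 1)))) =
    (if m = 0 then of_nat (2 * K + 1) else 0)"
proof (cases "m = 0")
  case True
  then show ?thesis by simp
next
  case False
  define x where "x = 2 * pi * of_int m / (2 * real K + 1)"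
  have N: "2 * real K + 1 > 0" by simp
  have ne: "cis x \<noteq> 1"
  proof
    assume "cis x = 1"
    then have "cos x = 1" by (metis cis.simps(1) one_complex.simps(1))
    then obtain q :: int where q: "x = of_int q * 2 * pi"
      using cos_one_2pi_int by blast
    then have "(2 * pi) * of_int m = (2 * pi) * (real_of_int q * (2 * real K + 1))"
      using N by (simp add: x_def field_simps)
    then have "of_int m = real_of_int q * (2 * real K + 1)" by simp
    then have "real_of_int m = of_int (q * (2 * int K + 1))" by simp
    then have m: "m = q * (2 * int K + 1)" by (simp only: of_int_eq_iff)
    with False have "q \<noteq> 0" by auto
    then have "1 * (2 * int K + 1) \<le> \<bar>q\<bar> * (2 * int K + 1)" by (intro mult_right_mono) auto
    also have "\<dots> = \<bar>m\<bar>" by (simp add: m abs_mult)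
    finally show False using assms by simp
  qed
  have one: "cis x ^ (2 * K + 1) = 1"
  proof -
    have "cis x ^ (2 * K + 1) = cis (real (2 * K + 1) * x)" by (rule Complex.DeMoivre)
    also have "real (2 * K + 1) * x = 2 * pi * of_int m"
      using N by (simp add: x_def field_simps)
    also have "cis \<dots> = 1" by (rule cis_multiple_2pi) simp
    finally show ?thesis .
  qed
  have "(\<Sum>j = - int K..int K. cis (of_int m * (2 * pi * of_int j / (2 * real K + 1)))) =
      (\<Sum>j = - int K..int K. cis (of_int j * x))"
    by (simp add: x_def mult_ac)
  also have "\<dots> = (\<Sum>i<2 * K + 1. cis (- real K * x) * cis x ^ i)"
    unfolding sum_int_interval Complex.DeMoivre cis_mult
    by (intro sum.cong refl arg_cong[where f = cis]) (simp add: algebra_simps)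
  also have "\<dots> = cis (- real K * x) * (\<Sum>i<2 * K + 1. cis x ^ i)"
    by (simp only: sum_distrib_left)
  also have "(\<Sum>i<2 * K + 1. cis x ^ i) = 0"
    by (subst geometric_sum[OF ne]) (simp only: one, simp)
  finally show ?thesis using False by simp
qed

text \<open>Expanding the squared modulus gives a double sum over k and l. Differences of two
  indices in [-K, K] are at most 2K in absolute value, so orthogonality in j kills every term off
  the diagonal.\<close>

lemma discrete_parseval:
  fixes a :: "int \<Rightarrow> real"
  shows "(\<Sum>j = - int K..int K.
      (cmod (\<Sum>k = - int K..int K. of_real (a k) * cis (of_int k * (2 * pi * of_int j / (2 * real K + 1)))))\<^sup>2) =
    (2 * real K + 1) * (\<Sum>k = - int K..int K. (a k)\<^sup>2)"
proof -
  let ?A = "{- int K..int K}"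
  define t where "t j = 2 * pi * of_int j / (2 * real K + 1)" for j :: int
  have "complex_of_real (\<Sum>j\<in>?A. (cmod (\<Sum>k\<in>?A. of_real (a k) * cis (of_int k * t j)))\<^sup>2) =
      (\<Sum>j\<in>?A. \<Sum>k\<in>?A. \<Sum>l\<in>?A. of_real (a k * a l) * cis (of_int (k - l) * t j))"
    by (simp add: complex_norm_square sum_product cis_cnj cis_mult mult.assoc mult.left_commute
        left_diff_distrib del: of_real_power)
  also have "\<dots> = (\<Sum>k\<in>?A. \<Sum>l\<in>?A. of_real (a k * a l) * (\<Sum>j\<in>?A. cis (of_int (k - l) * t j)))"
    by (subst sum.swap, rule sum.cong[OF refl], subst sum.swap) (simp only: sum_distrib_left)
  also have "\<dots> = (\<Sum>k\<in>?A. \<Sum>l\<in>?A. if l = k then of_real (a k * a l) * of_nat (2 * K + 1) else 0)"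
  proof (intro sum.cong refl)
    fix k l assume "k \<in> ?A" "l \<in> ?A"
    then have "\<bar>k - l\<bar> \<le> 2 * int K" by auto
    from sum_cis_orthogonal[OF this]
    show "of_real (a k * a l) * (\<Sum>j\<in>?A. cis (of_int (k - l) * t j)) =
        (if l = k then of_real (a k * a l) * of_nat (2 * K + 1) else (0 :: complex))"
      unfolding t_def by auto
  qed
  also have "\<dots> = of_real ((2 * real K + 1) * (\<Sum>k\<in>?A. (a k)\<^sup>2))"
    by (simp add: sum_distrib_left power2_eq_square mult_ac add.commute)
  finally show ?thesis unfolding t_def by (simp only: of_real_eq_iff)
qed

section \<open>Norm of a finite filter versus the supremum of its symbol\<close>

lemma sum_shift_supported:
  fixes g :: "int \<Rightarrow> 'a::comm_monoid_add"
  assumes "\<And>k. \<bar>k\<bar> > 2 * L \<Longrightarrow> g k = 0" "\<bar>s\<bar> \<le> L"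
  shows "(\<Sum>k = - (3 * L)..3 * L. g (k + s)) = (\<Sum>k = - (3 * L)..3 * L. g k)"
proof -
  have "(\<Sum>k = - (3 * L)..3 * L. g (k + s)) = (\<Sum>k = - (3 * L) + s..3 * L + s. g k)"
    by (rule sum.reindex_bij_witness[where i = "\<lambda>k. k - s" and j = "\<lambda>k. k + s"]) auto
  \<comment> \<open>Moving the window [-3L, 3L] by at most L still leaves it covering the support
    [-2L, 2L].\<close>
  also have "\<dots> = (\<Sum>k = - (2 * L)..2 * L. g k)"
    by (rule sum.mono_neutral_right) (use assms in auto)
  also have "\<dots> = (\<Sum>k = - (3 * L)..3 * L. g k)"
    by (rule sum.mono_neutral_left) (use assms in auto)
  finally show ?thesis .
qed

lemma finite_int_bounded:
  assumes "finite (F :: int set)"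
  obtains L :: nat where "\<And>k. k \<in> F \<Longrightarrow> \<bar>k\<bar> \<le> int L"
proof -
  have "\<bar>k\<bar> \<le> int (nat (\<Sum>j\<in>F. \<bar>j\<bar>))" if "k \<in> F" for k
    using member_le_sum[OF that, of abs] assms by (simp add: sum_nonneg)
  then show thesis using that by blast
qed

lemma ell2_norm_square: "(ell2_norm f)\<^sup>2 = (\<Sum>\<^sub>\<infinity>k. (f k)\<^sup>2)"
  by (simp add: ell2_norm_def infsum_nonneg)

lemma ell2_norm_nonneg: "ell2_norm f \<ge> 0"
  by (simp add: ell2_norm_def infsum_nonneg)

lemma sum_squares_le_ell2_norm:
  assumes "f \<in> ell2" "finite F"
  shows "(\<Sum>k\<in>F. (f k)\<^sup>2) \<le> (ell2_norm f)\<^sup>2"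
  unfolding ell2_norm_square
  by (rule finite_sum_le_infsum) (use assms in \<open>auto simp: ell2_def\<close>)

text \<open>A finite partial sum of squares of the output sees only finitely many values of f, so f
  may be cut off. On a window wide enough to hold all shifts of the cut-off sequence, the filter
  multiplies the discrete Fourier transform by the conjugate of the symbol, and Parseval before and
  after gives the factor \<open>M\<close>. The sample frequencies all lie in
  [-\<pi>, \<pi>].\<close>

lemma filter_norm_le:
  fixes I :: "'i set" and c :: "'i \<Rightarrow> real" and s :: "'i \<Rightarrow> int"
  assumes "finite I" and f: "f \<in> ell2"
    and M: "\<And>\<theta>. \<bar>\<theta>\<bar> \<le> pi \<Longrightarrow> cmod (\<Sum>i\<in>I. of_real (c i) * cis (of_int (s i) * \<theta>)) \<le> M"
  shows "ell2_norm (\<lambda>k. \<Sum>i\<in>I. c i * f (k + s i)) \<le> M * ell2_norm f"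
proof -
  define g where "g f k = (\<Sum>i\<in>I. c i * f (k + s i))" for f :: "int \<Rightarrow> real" and k
  have M0: "M \<ge> 0" by (rule order_trans[OF norm_ge_zero M[of 0]]) simp
  have bound: "(\<Sum>k\<in>F. (g f k)\<^sup>2) \<le> M\<^sup>2 * (ell2_norm f)\<^sup>2" if F: "finite F" for F
  proof -
    obtain L where L: "\<And>k. k \<in> F \<union> s ` I \<Longrightarrow> \<bar>k\<bar> \<le> int L"
      using finite_int_bounded[of "F \<union> s ` I"] F assms(1) by auto
    \<comment> \<open>\<open>F\<close> and all shifts lie in [-L, L]. Cutting f off outside
      [-2L, 2L] therefore leaves the output on \<open>F\<close> unchanged, and the filtered cut-off
      sequence lives in [-3L, 3L], so nothing leaves the window \<open>A\<close>.\<close>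
    define K where "K = 3 * L"
    define A where "A = {- int K..int K}"
    have A: "A = {- (3 * int L)..3 * int L}" by (simp add: A_def K_def)
    define h where "h k = (if \<bar>k\<bar> \<le> 2 * int L then f k else 0)" for k
    have gh: "g f k = g h k" if "k \<in> F" for k
    proof -
      have "h (k + s i) = f (k + s i)" if "i \<in> I" for i
        using L[of k] L[of "s i"] \<open>k \<in> F\<close> that by (simp add: h_def)
      then show ?thesis by (simp add: g_def)
    qed
    have FA: "F \<subseteq> A" using L by (force simp: A)
    define t where "t j = 2 * pi * of_int j / (2 * real K + 1)" for j :: int
    have t: "\<bar>t j\<bar> \<le> pi" if "j \<in> A" for j
    proof -
      have "2 * \<bar>j\<bar> \<le> 2 * int K + 1" using that by (auto simp: A_def)
      then have "2 * \<bar>real_of_int j\<bar> \<le> 2 * real K + 1" by linarith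
      then have "pi * (2 * \<bar>real_of_int j\<bar>) \<le> pi * (2 * real K + 1)"
        by (intro mult_left_mono) auto
      then show ?thesis by (simp add: t_def abs_mult divide_le_eq mult_ac)
    qed
    have ft: "(\<Sum>k\<in>A. of_real (g h k) * cis (of_int k * \<theta>)) =
        cnj (\<Sum>i\<in>I. of_real (c i) * cis (of_int (s i) * \<theta>)) *
        (\<Sum>k\<in>A. of_real (h k) * cis (of_int k * \<theta>))" for \<theta>
    proof -
      have "(\<Sum>k\<in>A. of_real (g h k) * cis (of_int k * \<theta>)) =
          (\<Sum>i\<in>I. \<Sum>k\<in>A. of_real (c i * h (k + s i)) * cis (of_int k * \<theta>))"
        by (subst sum.swap) (simp add: g_def sum_distrib_right)
      also have "\<dots> = (\<Sum>i\<in>I. of_real (c i) * cis (- (of_int (s i) * \<theta>)) *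
          (\<Sum>k\<in>A. of_real (h (k + s i)) * cis (of_int (k + s i) * \<theta>)))"
        unfolding sum_distrib_left
      proof (intro sum.cong refl)
        fix i k
        have "cis (of_int k * \<theta>) = cis (- (of_int (s i) * \<theta>)) * cis (of_int (k + s i) * \<theta>)"
          by (simp add: cis_mult distrib_right)
        then show "of_real (c i * h (k + s i)) * cis (of_int k * \<theta>) =
            of_real (c i) * cis (- (of_int (s i) * \<theta>)) *
            (of_real (h (k + s i)) * cis (of_int (k + s i) * \<theta>))"
          by (simp only: of_real_mult mult_ac)
      qed
      \<comment> \<open>Each shifted sum equals the unshifted one, so the transform of
        \<open>h\<close> becomes a common factor.\<close>
      also have "\<dots> = (\<Sum>i\<in>I. of_real (c i) * cis (- (of_int (s i) * \<theta>)) *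
          (\<Sum>k\<in>A. of_real (h k) * cis (of_int k * \<theta>)))"
      proof (rule sum.cong[OF refl])
        fix i assume "i \<in> I"
        then have "\<bar>s i\<bar> \<le> int L" using L by blast
        then have "(\<Sum>k\<in>A. of_real (h (k + s i)) * cis (of_int (k + s i) * \<theta>)) =
            (\<Sum>k\<in>A. of_real (h k) * cis (of_int k * \<theta>))"
          unfolding A
          by (intro sum_shift_supported[where g = "\<lambda>k. of_real (h k) * cis (of_int k * \<theta>)"])
             (auto simp: h_def)
        then show "of_real (c i) * cis (- (of_int (s i) * \<theta>)) *
            (\<Sum>k\<in>A. of_real (h (k + s i)) * cis (of_int (k + s i) * \<theta>)) =
            of_real (c i) * cis (- (of_int (s i) * \<theta>)) *
            (\<Sum>k\<in>A. of_real (h k) * cis (of_int k * \<theta>))" by (rule arg_cong)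
      qed
      also have "\<dots> = cnj (\<Sum>i\<in>I. of_real (c i) * cis (of_int (s i) * \<theta>)) *
        (\<Sum>k\<in>A. of_real (h k) * cis (of_int k * \<theta>))"
        by (simp add: sum_distrib_right cis_cnj)
      finally show ?thesis .
    qed
    have "(2 * real K + 1) * (\<Sum>k\<in>A. (g h k)\<^sup>2) =
        (\<Sum>j\<in>A. (cmod (\<Sum>k\<in>A. of_real (g h k) * cis (of_int k * t j)))\<^sup>2)"
      unfolding A_def t_def discrete_parseval ..
    also have "\<dots> \<le> (\<Sum>j\<in>A. M\<^sup>2 * (cmod (\<Sum>k\<in>A. of_real (h k) * cis (of_int k * t j)))\<^sup>2)"
      unfolding ft norm_mult power_mult_distrib complex_mod_cnj
      by (intro sum_mono mult_right_mono power_mono M t) auto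
    also have "\<dots> = M\<^sup>2 * ((2 * real K + 1) * (\<Sum>k\<in>A. (h k)\<^sup>2))"
      unfolding A_def t_def sum_distrib_left[symmetric] discrete_parseval ..
    finally have "(2 * real K + 1) * (\<Sum>k\<in>A. (g h k)\<^sup>2) \<le>
        (2 * real K + 1) * (M\<^sup>2 * (\<Sum>k\<in>A. (h k)\<^sup>2))" by (simp only: mult_ac)
    then have *: "(\<Sum>k\<in>A. (g h k)\<^sup>2) \<le> M\<^sup>2 * (\<Sum>k\<in>A. (h k)\<^sup>2)"
      by (rule mult_left_le_imp_le) simp
    have "(\<Sum>k\<in>F. (g f k)\<^sup>2) = (\<Sum>k\<in>F. (g h k)\<^sup>2)" by (simp add: gh)
    also have "\<dots> \<le> (\<Sum>k\<in>A. (g h k)\<^sup>2)" by (rule sum_mono2[OF _ FA]) (auto simp: A_def)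
    also note *
    also have "M\<^sup>2 * (\<Sum>k\<in>A. (h k)\<^sup>2) \<le> M\<^sup>2 * (\<Sum>k\<in>A. (f k)\<^sup>2)"
      by (intro mult_left_mono sum_mono) (simp_all add: h_def)
    also have "\<dots> \<le> M\<^sup>2 * (ell2_norm f)\<^sup>2"
      by (intro mult_left_mono sum_squares_le_ell2_norm[OF f]) (simp_all add: A_def)
    finally show ?thesis .
  qed
  have "g f \<in> ell2" unfolding g_def by (rule finite_filter_bounded(1)[OF f])
  then have "(ell2_norm (g f))\<^sup>2 \<le> M\<^sup>2 * (ell2_norm f)\<^sup>2"
    unfolding ell2_norm_square[of "g f"] ell2_def
    by (intro infsum_le_finite_sums) (auto intro: bound)
  then have "ell2_norm (g f) \<le> M * ell2_norm f"
    unfolding power_mult_distrib[symmetric]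
    by (rule power2_le_imp_le) (simp add: M0 ell2_norm_nonneg)
  then show ?thesis by (simp only: g_def[abs_def])
qed

text \<open>Truncated plane waves are approximate eigenfunctions. Their real and imaginary parts have
  squares adding up to 1, so no lower bound on sums of \<open>cos\<^sup>2\<close> is needed.\<close>

lemma symbol_le_filter_norm:
  fixes I :: "'i set" and c :: "'i \<Rightarrow> real" and s :: "'i \<Rightarrow> int"
  assumes "finite I"
    and R: "\<And>f. f \<in> ell2 \<Longrightarrow> ell2_norm (\<lambda>k. \<Sum>i\<in>I. c i * f (k + s i)) \<le> R * ell2_norm f"
    and R0: "R \<ge> 0"
  shows "cmod (\<Sum>i\<in>I. of_real (c i) * cis (of_int (s i) * \<theta>)) \<le> R"
proof -
  define g where "g f = (\<lambda>k. \<Sum>i\<in>I. c i * f (k + s i))" for f :: "int \<Rightarrow> real"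
  define S where "S = (\<Sum>i\<in>I. of_real (c i) * cis (of_int (s i) * \<theta>))"
  obtain L where "\<And>k. k \<in> s ` I \<Longrightarrow> \<bar>k\<bar> \<le> int L"
    using finite_int_bounded[OF finite_imageI[OF assms(1)]] by blast
  then have L: "\<And>i. i \<in> I \<Longrightarrow> \<bar>s i\<bar> \<le> int L" by blast
  \<comment> \<open>The waves are cut off to \<open>A\<close>, which exceeds \<open>B\<close> by L
    on each side, so on \<open>B\<close> the filter acts as on the full plane wave. The ratio of the
    two window lengths tends to 1 as m grows.\<close>
  have ineq: "(2 * real m + 1) * (cmod S)\<^sup>2 \<le> R\<^sup>2 * (2 * real m + 2 * real L + 1)" for m
  proof -
    define A where "A = {- int (m + L)..int (m + L)}"
    define B where "B = {- int m..int m}"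
    define p where "p k = (if k \<in> A then cos (of_int k * \<theta>) else 0)" for k :: int
    define q where "q k = (if k \<in> A then sin (of_int k * \<theta>) else 0)" for k :: int
    have norm: "f \<in> ell2 \<and> (ell2_norm f)\<^sup>2 = (\<Sum>k\<in>A. (f k)\<^sup>2)" if "\<And>k. k \<notin> A \<Longrightarrow> f k = 0" for f
    proof -
      have "((\<lambda>k. (f k)\<^sup>2) has_sum (\<Sum>k\<in>A. (f k)\<^sup>2)) UNIV"
        by (rule has_sum_finite_neutralI) (auto simp: A_def that)
      then show ?thesis
        by (auto simp: ell2_def ell2_norm_square infsumI has_sum_imp_summable)
    qed
    have pq: "p \<in> ell2" "(ell2_norm p)\<^sup>2 = (\<Sum>k\<in>A. (p k)\<^sup>2)"
      "q \<in> ell2" "(ell2_norm q)\<^sup>2 = (\<Sum>k\<in>A. (q k)\<^sup>2)"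
      using norm[of p] norm[of q] by (simp_all add: p_def q_def)
    have gR: "(ell2_norm (g f))\<^sup>2 \<le> R\<^sup>2 * (ell2_norm f)\<^sup>2" "g f \<in> ell2" if "f \<in> ell2" for f
      using power_mono[OF R[OF that] ell2_norm_nonneg, of 2] finite_filter_bounded(1)[OF that]
      by (auto simp: g_def power_mult_distrib)
    have eig: "(g p k)\<^sup>2 + (g q k)\<^sup>2 = (cmod S)\<^sup>2" if "k \<in> B" for k
    proof -
      have in_A: "k + s i \<in> A" if "i \<in> I" for i
        using L[OF that] \<open>k \<in> B\<close> by (auto simp: A_def B_def)
      have "Complex (g p k) (g q k) = (\<Sum>i\<in>I. of_real (c i) * cis (of_int (k + s i) * \<theta>))"
        by (simp add: complex_eq_iff g_def p_def q_def in_A)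
      also have "\<dots> = cis (of_int k * \<theta>) * S"
        unfolding S_def sum_distrib_left
        by (intro sum.cong refl) (simp add: cis_mult[symmetric] distrib_right)
      finally have "cmod (Complex (g p k) (g q k)) = cmod S" by (simp add: norm_mult)
      then show ?thesis by (metis cmod_power2 complex.sel)
    qed
    have "(2 * real m + 1) * (cmod S)\<^sup>2 = (\<Sum>k\<in>B. (g p k)\<^sup>2 + (g q k)\<^sup>2)"
      by (simp add: eig) (simp add: B_def)
    also have "\<dots> \<le> (ell2_norm (g p))\<^sup>2 + (ell2_norm (g q))\<^sup>2"
      unfolding sum.distrib
      by (intro add_mono sum_squares_le_ell2_norm gR pq) (simp_all add: B_def)
    also have "\<dots> \<le> R\<^sup>2 * (ell2_norm p)\<^sup>2 + R\<^sup>2 * (ell2_norm q)\<^sup>2"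
      by (intro add_mono gR pq)
    also have "\<dots> = R\<^sup>2 * (\<Sum>k\<in>A. (p k)\<^sup>2 + (q k)\<^sup>2)"
      by (simp add: pq sum.distrib distrib_left)
    also have "(\<Sum>k\<in>A. (p k)\<^sup>2 + (q k)\<^sup>2) = (\<Sum>k\<in>A. 1)"
      by (intro sum.cong) (auto simp: p_def q_def)
    also have "\<dots> = 2 * real m + 2 * real L + 1" by (simp add: A_def)
    finally show ?thesis .
  qed
  have "(cmod S)\<^sup>2 \<le> R\<^sup>2"
  \<comment> \<open>Were |S|^2 larger than R^2, \<open>ineq\<close> would bound m (|S|^2 - R^2) by
    R^2 L for every m, against the Archimedean property.\<close>
  proof (rule ccontr)
    assume "\<not> (cmod S)\<^sup>2 \<le> R\<^sup>2"
    then have pos: "(cmod S)\<^sup>2 - R\<^sup>2 > 0" by simp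
    then obtain m where m: "R\<^sup>2 * real L < real m * ((cmod S)\<^sup>2 - R\<^sup>2)"
      using reals_Archimedean3 by blast
    have "2 * (real m * ((cmod S)\<^sup>2 - R\<^sup>2)) + ((cmod S)\<^sup>2 - R\<^sup>2) \<le> 2 * (R\<^sup>2 * real L)"
      using ineq[of m] by (simp add: algebra_simps)
    then show False using m pos by linarith
  qed
  then show ?thesis unfolding S_def[symmetric] using R0 by (rule power2_le_imp_le)
qed

section \<open>The symbol of the smoothed second difference\<close>

text \<open>The Dirichlet kernel at angle 2x. The right side is sin((2n+1)x), kept expanded so that
  the induction step is a polynomial identity in the sines and cosines of x and 2nx modulo sin^2 +
  cos^2 = 1.\<close>

lemma sin_mult_dirichlet_sum:
  "sin x * (\<Sum>l = - int n..int n. cos (2 * of_int l * x)) =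
    sin (2 * real n * x) * cos x + cos (2 * real n * x) * sin x"
proof (induction n)
  case (Suc n)
  have e: "2 * real (Suc n) * x = 2 * real n * x + 2 * x" by (simp add: algebra_simps)
  have "2 * of_int (int (Suc n)) * x = 2 * real (Suc n) * x"
    "2 * of_int (- int (Suc n)) * x = - (2 * real (Suc n) * x)" by (simp_all add: algebra_simps)
  then have "sin x * (\<Sum>l = - int (Suc n)..int (Suc n). cos (2 * of_int l * x)) =
      sin (2 * real n * x) * cos x + cos (2 * real n * x) * sin x + 2 * sin x * cos (2 * real (Suc n) * x)"
    unfolding sum_int_interval_Suc distrib_left Suc.IH by (simp only: cos_minus)
  also have "\<dots> = sin (2 * real (Suc n) * x) * cos x + cos (2 * real (Suc n) * x) * sin x"
    using sin_cos_squared_add[of x] unfolding e sin_add cos_add sin_double cos_double by algebra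
  finally show ?case .
qed simp

text \<open>Passing from n to n+1 raises every weight n^2 - l^2 by 2n+1, so the sum grows by 2n+1
  times the Dirichlet sum, whose closed form is known.\<close>

lemma sin_cube_mult_parabola_sum:
  "2 * sin x ^ 3 * (\<Sum>l = - int n..int n. ((real n)\<^sup>2 - (of_int l)\<^sup>2) * cos (2 * of_int l * x)) =
    sin (2 * real n * x) * cos x - 2 * real n * cos (2 * real n * x) * sin x"
proof (induction n)
  case (Suc n)
  have e: "2 * real (Suc n) * x = 2 * real n * x + 2 * x" by (simp add: algebra_simps)
  define D where "D = (\<Sum>l = - int n..int n. cos (2 * of_int l * x))"
  define P where "P = (\<Sum>l = - int n..int n. ((real n)\<^sup>2 - (of_int l)\<^sup>2) * cos (2 * of_int l * x))"
  \<comment> \<open>The two new end terms l = n+1 and l = -(n+1) have weight 0.\<close>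
  have "(\<Sum>l = - int (Suc n)..int (Suc n). ((real (Suc n))\<^sup>2 - (of_int l)\<^sup>2) * cos (2 * of_int l * x)) =
      (\<Sum>l = - int n..int n. ((real (Suc n))\<^sup>2 - (of_int l)\<^sup>2) * cos (2 * of_int l * x))"
    unfolding sum_int_interval_Suc
    by (simp only: of_int_minus power2_minus of_int_of_nat_eq diff_self mult_zero_left add_0_right)
  also have "\<dots> = (\<Sum>l = - int n..int n. ((real n)\<^sup>2 - (of_int l)\<^sup>2) * cos (2 * of_int l * x)
         + (2 * real n + 1) * cos (2 * of_int l * x))"
    by (intro sum.cong refl) (simp add: power2_eq_square algebra_simps)
  also have "\<dots> = P + (2 * real n + 1) * D"
    by (simp only: sum.distrib sum_distrib_left P_def D_def)
  finally have "2 * sin x ^ 3 * (\<Sum>l = - int (Suc n)..int (Suc n).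
        ((real (Suc n))\<^sup>2 - (of_int l)\<^sup>2) * cos (2 * of_int l * x)) =
      2 * sin x ^ 3 * (P + (2 * real n + 1) * D)" by (rule arg_cong)
  also have "\<dots> = 2 * sin x ^ 3 * P + 2 * (sin x)\<^sup>2 * (2 * real n + 1) * (sin x * D)"
    by algebra
  also have "\<dots> = sin (2 * real n * x) * cos x - 2 * real n * cos (2 * real n * x) * sin x
      + 2 * (sin x)\<^sup>2 * (2 * real n + 1) * (sin (2 * real n * x) * cos x + cos (2 * real n * x) * sin x)"
    unfolding P_def D_def Suc.IH sin_mult_dirichlet_sum ..
  also have "\<dots> = sin (2 * real (Suc n) * x) * cos x
      - 2 * (real n + 1) * cos (2 * real (Suc n) * x) * sin x"
    using sin_cos_squared_add[of x] unfolding e sin_add cos_add sin_double cos_double by algebra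
  finally show ?case by (simp only: of_nat_Suc add.commute)
qed simp

definition lap_coeff :: "int \<Rightarrow> real" where
  "lap_coeff d = (if d = 1 then - 2 else 1)"

text \<open>The Fourier multiplier of f \<mapsto> \<open>laplacian (convolve n (E n) f)\<close>,
  indexed by pairs so that it has the shape of the symbol in the filter lemmas.\<close>

definition E_symbol :: "nat \<Rightarrow> real \<Rightarrow> complex" where
  "E_symbol n \<theta> = (\<Sum>i\<in>{- int n..int n} \<times> {0, 1, 2}.
     of_real (E n (fst i) * lap_coeff (snd i)) * cis (of_int (snd i - fst i) * \<theta>))"

text \<open>Presents the composite operator as one finite filter with shifts d - l, to which both
  norm estimates apply. Different pairs may share a shift.\<close>

lemma laplacian_convolve_eq:
  "laplacian (convolve n u f) =
    (\<lambda>k. \<Sum>i\<in>{- int n..int n} \<times> {0, 1, 2}. u (fst i) * lap_coeff (snd i) * f (k + (snd i - fst i)))"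
proof
  fix k
  have "(\<Sum>i\<in>{- int n..int n} \<times> {0, 1, 2}. u (fst i) * lap_coeff (snd i) * f (k + (snd i - fst i))) =
      (\<Sum>l = - int n..int n. \<Sum>d\<in>{0, 1, 2}. u l * lap_coeff d * f (k + (d - l)))"
    by (simp only: sum.cartesian_product split_def)
  also have "\<dots> = laplacian (convolve n u f) k"
    by (simp add: laplacian_def convolve_def lap_coeff_def sum_subtractf sum.distrib
        sum_distrib_left algebra_simps)
  finally show "laplacian (convolve n u f) k =
    (\<Sum>i\<in>{- int n..int n} \<times> {0, 1, 2}. u (fst i) * lap_coeff (snd i) * f (k + (snd i - fst i)))" ..
qed

text \<open>The symbol is a product. \<open>E n\<close> is even, so its factor is a real cosine sum;
  the stencil 1, -2, 1 contributes \<open>cis \<theta>\<close> times 2 cos \<theta> - 2 = -4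
  sin^2(\<theta>/2). Hence 12 = 3 * 4.\<close>

lemma cmod_E_symbol:
  assumes "n > 0"
  shows "cmod (E_symbol n \<theta>) =
    12 / (real n * (4 * (real n)\<^sup>2 - 1)) * (sin (\<theta> / 2))\<^sup>2 *
    \<bar>\<Sum>l = - int n..int n. ((real n)\<^sup>2 - (of_int l)\<^sup>2) * cos (of_int l * \<theta>)\<bar>"
proof -
  define C where "C = 3 / (real n * (4 * (real n)\<^sup>2 - 1))"
  define P where "P = (\<Sum>l = - int n..int n. ((real n)\<^sup>2 - (of_int l)\<^sup>2) * cos (of_int l * \<theta>))"
  have "(real n)\<^sup>2 \<ge> 1" using assms by simp
  then have C: "C \<ge> 0" by (simp add: C_def)
  have E_eq: "E n l = C * ((real n)\<^sup>2 - (of_int l)\<^sup>2)" for l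
    by (simp add: E_def C_def)
  have neg: "(\<Sum>l = - int n..int n. E n l * sin (of_int l * \<theta>)) = 0"
  proof -
    have "(\<Sum>l = - int n..int n. E n l * sin (of_int l * \<theta>)) =
      (\<Sum>l = - int n..int n. - (E n l * sin (of_int l * \<theta>)))"
      by (rule sum.reindex_bij_witness[where i = uminus and j = uminus]) (auto simp: E_eq)
    then show ?thesis by (simp add: sum_negf)
  qed
  have "E_symbol n \<theta> = (\<Sum>l = - int n..int n. \<Sum>d\<in>{0, 1, 2}.
      of_real (E n l * lap_coeff d) * cis (of_int (d - l) * \<theta>))"
    by (simp only: E_symbol_def sum.cartesian_product split_def)
  also have "\<dots> = (\<Sum>l = - int n..int n. of_real (E n l) * cis (- (of_int l * \<theta>))) *
      (\<Sum>d\<in>{0, 1, 2}. of_real (lap_coeff d) * cis (of_int d * \<theta>))"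
    unfolding sum_product
  proof (intro sum.cong refl)
    fix l d :: int
    have "cis (of_int (d - l) * \<theta>) = cis (- (of_int l * \<theta>)) * cis (of_int d * \<theta>)"
      by (simp add: cis_mult left_diff_distrib)
    then show "of_real (E n l * lap_coeff d) * cis (of_int (d - l) * \<theta>) =
        of_real (E n l) * cis (- (of_int l * \<theta>)) * (of_real (lap_coeff d) * cis (of_int d * \<theta>))"
      by (simp only: of_real_mult mult_ac)
  qed
  also have "(\<Sum>l = - int n..int n. of_real (E n l) * cis (- (of_int l * \<theta>))) = of_real (C * P)"
  proof (rule complex_eqI)
    show "Re (\<Sum>l = - int n..int n. of_real (E n l) * cis (- (of_int l * \<theta>))) = Re (of_real (C * P))"
      by (simp add: E_eq P_def sum_distrib_left mult.assoc)
    show "Im (\<Sum>l = - int n..int n. of_real (E n l) * cis (- (of_int l * \<theta>))) = Im (of_real (C * P))"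
      using neg by (simp add: sum_negf)
  qed
  also have "(\<Sum>d\<in>{0, 1, 2}. of_real (lap_coeff d) * cis (of_int d * \<theta>)) =
      cis \<theta> * of_real (- 4 * (sin (\<theta> / 2))\<^sup>2)"
  proof -
    have "cos \<theta> = 1 - 2 * (sin (\<theta> / 2))\<^sup>2" using cos_double_sin[of "\<theta> / 2"] by simp
    then have "- 4 * (sin (\<theta> / 2))\<^sup>2 = 2 * cos \<theta> - 2" by simp
    moreover have "(\<Sum>d\<in>{0, 1, 2}. of_real (lap_coeff d) * cis (of_int d * \<theta>)) =
       cis \<theta> * of_real (2 * cos \<theta> - 2)"
      by (simp add: lap_coeff_def complex_eq_iff cos_double_cos[of \<theta>] sin_double[of \<theta>]
        power2_eq_square left_diff_distrib right_diff_distrib)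
    ultimately show ?thesis by simp
  qed
  finally have "cmod (E_symbol n \<theta>) = C * \<bar>P\<bar> * (4 * (sin (\<theta> / 2))\<^sup>2)"
    using C by (simp add: norm_mult norm_power abs_mult)
  then show ?thesis by (simp add: C_def P_def)
qed

text \<open>With x = \<theta>/2, write sin(2nx) cos x as 2n sin x times x cot x sinc(2nx) in the
  closed form of the parabola sum, then cancel 2 sin x.\<close>

lemma cmod_E_symbol_sinc:
  assumes "n > 0" "sin (\<theta> / 2) \<noteq> 0"
  shows "cmod (E_symbol n \<theta>) = 12 / (4 * (real n)\<^sup>2 - 1) *
    \<bar>\<theta> / 2 * cot (\<theta> / 2) * sinc (real n * \<theta>) - cos (real n * \<theta>)\<bar>"
proof -
  define P where "P = (\<Sum>l = - int n..int n. ((real n)\<^sup>2 - (of_int l)\<^sup>2) * cos (of_int l * \<theta>))"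
  define x where "x = \<theta> / 2"
  define Q where "Q = x * cot x * sinc (real n * \<theta>) - cos (real n * \<theta>)"
  have \<theta>: "\<theta> = 2 * x" "\<theta> \<noteq> 0" "x \<noteq> 0" using assms(2) by (auto simp: x_def)
  have s: "sin x \<noteq> 0" using assms(2) by (simp add: x_def)
  have "2 * sin x ^ 3 * P =
      sin (2 * real n * x) * cos x - 2 * real n * cos (2 * real n * x) * sin x"
    using sin_cube_mult_parabola_sum[of x n] by (simp add: P_def \<theta>(1) mult.assoc mult.left_commute)
  also have "\<dots> = 2 * real n * sin x * Q"
    using s assms(1) \<theta> by (simp add: Q_def cot_def field_simps)
  finally have "(2 * sin x) * ((sin x)\<^sup>2 * P) = (2 * sin x) * (real n * Q)"
    by algebra
  then have "(sin x)\<^sup>2 * P = real n * Q" using s by simp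
  then have *: "(sin x)\<^sup>2 * \<bar>P\<bar> = real n * \<bar>Q\<bar>"
    by (metis abs_mult abs_of_nat abs_power2)
  have "cmod (E_symbol n \<theta>) = 12 / (real n * (4 * (real n)\<^sup>2 - 1)) * ((sin x)\<^sup>2 * \<bar>P\<bar>)"
    unfolding cmod_E_symbol[OF assms(1)] P_def x_def by (simp only: mult.assoc)
  then show ?thesis unfolding * x_def[symmetric] Q_def[symmetric] using assms(1) by simp
qed

section \<open>The extremal constant\<close>

text \<open>The value at \<open>5\<pi>/6\<close>, close to the maximiser, exceeds \<open>21/20\<close>.\<close>

lemma mu_ge: "mu \<ge> 21 / 20"
proof -
  have pi: "pi \<le> 3.1416" using pi_approx by simp
  \<comment> \<open>The two decimals are chosen so that 0.19 + 1.72/2 is exactly 21/20.\<close>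
  then have p: "3 / (5 * pi) \<ge> 0.19" by (simp add: field_simps)
  have q: "sqrt 3 \<ge> 1.72" by (rule real_le_rsqrt) (simp add: power2_eq_square)
  have e: "5 * pi / 6 = pi - pi / 6" by simp
  have "sin (5 * pi / 6) = 1 / 2" "cos (5 * pi / 6) = - sqrt 3 / 2"
    unfolding e by (simp_all only: sin_pi_minus cos_pi_minus sin_30 cos_30)
  then have v: "sinc (5 * pi / 6) - cos (5 * pi / 6) = 3 / (5 * pi) + sqrt 3 / 2"
    by simp
  have "5 * pi / 6 \<in> {0..16}" using pi by simp
  from mu_is_maximum(2)[OF this] have "3 / (5 * pi) + sqrt 3 / 2 \<le> mu"
    unfolding v by simp
  then show ?thesis using p q by simp
qed

text \<open>Beyond 16, Cauchy--Schwarz gives the bound \<open>sqrt (1 + 1 / \<alpha>\<^sup>2)\<close>.\<close>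

lemma abs_sinc_minus_cos_le_mu: "\<bar>sinc \<alpha> - cos \<alpha>\<bar> \<le> mu"
proof -
  have pos: "\<bar>sinc a - cos a\<bar> \<le> mu" if "a \<ge> 0" for a
  proof (cases "a \<le> 16")
    case True
    then show ?thesis using mu_is_maximum(2) that by simp
  next
    case False
    define b where "b = 1 / a"
    have b: "0 \<le> b" "b \<le> 1 / 16" using False by (auto simp: b_def field_simps)
    have "(sinc a - cos a)\<^sup>2 = (b * sin a - cos a)\<^sup>2" using False by (simp add: b_def)
    \<comment> \<open>Lagrange's identity for the vectors (b, -1) and (sin a, cos a).\<close>
    also have "\<dots> = (1 + b\<^sup>2) * ((sin a)\<^sup>2 + (cos a)\<^sup>2) - (sin a + b * cos a)\<^sup>2" by algebra
    also have "\<dots> \<le> 1 + b\<^sup>2" by simp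
    also have "\<dots> \<le> 1 + (1 / 16)\<^sup>2" using b by (intro add_left_mono power_mono) auto
    also have "\<dots> \<le> (21 / 20)\<^sup>2" by (simp add: power2_eq_square)
    finally have "\<bar>sinc a - cos a\<bar> \<le> 21 / 20"
      by (simp only: abs_le_square_iff[symmetric] abs_numeral abs_divide)
    then show ?thesis using mu_ge by linarith
  qed
  \<comment> \<open>Both sinc and cos are even, so negative arguments reduce to positive
    ones.\<close>
  show ?thesis
  proof (cases "\<alpha> \<ge> 0")
    case False
    then show ?thesis using pos[of "- \<alpha>"] by (simp split: if_splits)
  qed (rule pos)
qed

text \<open>The difference sin x - x cos x vanishes at 0 and has derivative x sin x, which is
  nonnegative on [0, \<pi>].\<close>

lemma mult_cos_le_sin:
  fixes x :: real
  assumes "0 \<le> x" "x \<le> pi"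
  shows "x * cos x \<le> sin x"
proof -
  have "sin 0 - 0 * cos 0 \<le> sin x - x * cos x"
  proof (rule DERIV_nonneg_imp_nondecreasing[OF assms(1)])
    fix y assume y: "0 \<le> y" "y \<le> x"
    have "((\<lambda>x. sin x - x * cos x) has_real_derivative y * sin y) (at y)"
      by (auto intro!: derivative_eq_intros)
    moreover have "y * sin y \<ge> 0" using y assms by (intro mult_nonneg_nonneg sin_ge_zero) auto
    ultimately show "\<exists>d. ((\<lambda>x. sin x - x * cos x) has_real_derivative d) (at y) \<and> 0 \<le> d" by blast
  qed
  then show ?thesis by simp
qed

text \<open>As x cot x is even, take x > 0. The lower bound is cos x \<ge> 0 up to \<pi>/2, and the
  upper one is x cos x \<le> sin x.\<close>

lemma mult_cot_bounds:
  fixes x :: real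
  assumes "\<bar>x\<bar> \<le> pi / 2" "x \<noteq> 0"
  shows "0 \<le> x * cot x" "x * cot x \<le> 1"
proof -
  have *: "0 \<le> y * cot y \<and> y * cot y \<le> 1" if y: "0 < y" "y \<le> pi / 2" for y :: real
  proof -
    have "sin y > 0" using y by (intro sin_gt_zero) auto
    moreover have "cos y \<ge> 0" using y by (intro cos_ge_zero) auto
    moreover have "y * cos y \<le> sin y" using y by (intro mult_cos_le_sin) auto
    ultimately show ?thesis using y by (simp add: cot_def)
  qed
  have "\<bar>x\<bar> * cot \<bar>x\<bar> = x * cot x" by (simp add: abs_if cot_def)
  then show "0 \<le> x * cot x" "x * cot x \<le> 1"
    using *[of "\<bar>x\<bar>"] assms by auto
qed

lemma cmod_E_symbol_le:
  assumes n: "n > 0" and \<theta>: "\<bar>\<theta>\<bar> \<le> pi"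
  shows "cmod (E_symbol n \<theta>) \<le> 12 * mu / (4 * (real n)\<^sup>2 - 1)"
proof -
  have "(real n)\<^sup>2 \<ge> 1" using n by simp
  then have d: "4 * (real n)\<^sup>2 - 1 > 0" by linarith
  show ?thesis
  proof (cases "\<theta> = 0")
    case True
    then show ?thesis using n d mu_ge by (simp add: cmod_E_symbol)
  next
    case False
    define t where "t = \<theta> / 2 * cot (\<theta> / 2)"
    define \<alpha> where "\<alpha> = real n * \<theta>"
    have s: "sin (\<theta> / 2) \<noteq> 0"
    proof
      assume "sin (\<theta> / 2) = 0"
      then have "\<theta> / 2 = 0"
        by (rule sin_eq_0_pi[rotated 2]) (use \<theta> pi_gt_zero in linarith)+
      then show False using False by simp
    qed
    have t: "0 \<le> t" "t \<le> 1"
      unfolding t_def using \<theta> False by (intro mult_cot_bounds; simp)+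
    \<comment> \<open>A convex combination of sinc \<alpha> - cos \<alpha> and -cos \<alpha>. The
      first is bounded by \<open>mu\<close> for every real \<alpha>, the second because
      \<open>mu\<close> exceeds 1.\<close>
    have "\<bar>t * sinc \<alpha> - cos \<alpha>\<bar> = \<bar>t * (sinc \<alpha> - cos \<alpha>) + (1 - t) * (- cos \<alpha>)\<bar>"
      by (simp only: algebra_simps)
    also have "\<dots> \<le> t * \<bar>sinc \<alpha> - cos \<alpha>\<bar> + (1 - t) * \<bar>cos \<alpha>\<bar>"
      by (rule order_trans[OF abs_triangle_ineq])
         (simp only: abs_mult abs_minus_cancel abs_of_nonneg t diff_ge_0_iff_ge)
    also have "\<dots> \<le> t * mu + (1 - t) * mu"
    proof (intro add_mono mult_left_mono abs_sinc_minus_cos_le_mu t)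
      show "\<bar>cos \<alpha>\<bar> \<le> mu" using mu_ge abs_cos_le_one[of \<alpha>] by linarith
    qed (use t in simp)
    also have "\<dots> = mu" by (simp add: algebra_simps)
    finally have "12 / (4 * (real n)\<^sup>2 - 1) * \<bar>t * sinc \<alpha> - cos \<alpha>\<bar> \<le> 12 / (4 * (real n)\<^sup>2 - 1) * mu"
      using d by (intro mult_left_mono) auto
    then show ?thesis
      unfolding cmod_E_symbol_sinc[OF n s] t_def \<alpha>_def by (simp only: times_divide_eq_left)
  qed
qed

section \<open>The asymptotics of the operator norm\<close>

definition opnorm :: "nat \<Rightarrow> real" where
  "opnorm n = (SUP f\<in>ell2 - {\<lambda>_. 0}. ell2_norm (laplacian (convolve n (E n) f)) / ell2_norm f)"

lemma opnorm_le:
  assumes "n > 0"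
  shows "opnorm n \<le> 12 * mu / (4 * (real n)\<^sup>2 - 1)"
  unfolding opnorm_def
proof (rule cSUP_least[OF ratios_nonempty])
  fix f :: "int \<Rightarrow> real" assume f: "f \<in> ell2 - {\<lambda>_. 0}"
  then have pos: "ell2_norm f > 0" using ell2_norm_pos by blast
  have "ell2_norm (laplacian (convolve n (E n) f)) \<le> 12 * mu / (4 * (real n)\<^sup>2 - 1) * ell2_norm f"
    unfolding laplacian_convolve_eq
  proof (rule filter_norm_le)
    show "cmod (\<Sum>i\<in>{- int n..int n} \<times> {0, 1, 2}.
        of_real (E n (fst i) * lap_coeff (snd i)) * cis (of_int (snd i - fst i) * \<theta>))
      \<le> 12 * mu / (4 * (real n)\<^sup>2 - 1)" if "\<bar>\<theta>\<bar> \<le> pi" for \<theta>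
      using cmod_E_symbol_le[OF assms that] unfolding E_symbol_def .
  qed (use f in simp_all)
  then show "ell2_norm (laplacian (convolve n (E n) f)) / ell2_norm f \<le> 12 * mu / (4 * (real n)\<^sup>2 - 1)"
    using pos by (simp only: pos_divide_le_eq)
qed

lemma cmod_E_symbol_le_opnorm: "cmod (E_symbol n \<theta>) \<le> opnorm n"
proof -
  have up: "ell2_norm (laplacian (convolve n (E n) f)) / ell2_norm f \<le> opnorm n"
    if "f \<in> ell2 - {\<lambda>_. 0}" for f
    unfolding opnorm_def by (rule cSUP_upper[OF that ratios_bdd_above])
  \<comment> \<open>Any single ratio is nonnegative and lies below the supremum.\<close>
  obtain f :: "int \<Rightarrow> real" where "f \<in> ell2 - {\<lambda>_. 0}" using ratios_nonempty by blast
  from up[OF this] have nonneg: "opnorm n \<ge> 0"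
    by (rule order_trans[rotated]) (simp add: ell2_norm_nonneg)
  have "ell2_norm (laplacian (convolve n (E n) f)) \<le> opnorm n * ell2_norm f" if "f \<in> ell2" for f
  proof (cases "f = (\<lambda>_. 0)")
    case True
    then show ?thesis by (simp add: laplacian_def convolve_def ell2_norm_def)
  next
    case False
    then show ?thesis using up[of f] that ell2_norm_pos[of f] by (simp add: pos_divide_le_eq)
  qed
  then show ?thesis
    unfolding E_symbol_def laplacian_convolve_eq
    by (intro symbol_le_filter_norm nonneg) simp_all
qed

theorem theorem2:
  shows "(\<lambda>n. SUP f\<in>ell2 - {\<lambda>_. 0}. ell2_norm (laplacian (convolve n (E n) f)) / ell2_norm f)
           \<sim>[at_top] (\<lambda>n::nat. (3 * mu / pi) * (pi / (real n)\<^sup>2))"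
proof -
  have mu: "mu > 0" using mu_ge by simp
  obtain \<alpha> where \<alpha>: "\<alpha> \<in> {0..16}" "mu = \<bar>sinc \<alpha> - cos \<alpha>\<bar>"
    using mu_is_maximum(1) by auto
  \<comment> \<open>At \<alpha> = 0 the expression sinc \<alpha> - cos \<alpha> is 0, which is not
    \<open>mu\<close>.\<close>
  then have pos: "\<alpha> > 0" using mu by (cases "\<alpha> = 0") auto
  \<comment> \<open>The test frequency is \<theta> = \<alpha>/n, so that n \<theta> stays at the
    maximiser while x cot x at x = \<theta>/2 tends to 1.\<close>
  define t where "t n = \<alpha> / real n / 2 * cot (\<alpha> / real n / 2)" for n
  define lo where "lo n = 4 * (real n)\<^sup>2 / (4 * (real n)\<^sup>2 - 1) * (\<bar>t n * sinc \<alpha> - cos \<alpha>\<bar> / mu)" for n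
  have "t \<longlonglongrightarrow> 1" unfolding t_def cot_def using pos by real_asymp
  moreover have lim: "(\<lambda>n. 4 * (real n)\<^sup>2 / (4 * (real n)\<^sup>2 - 1)) \<longlonglongrightarrow> 1" by real_asymp
  ultimately have "lo \<longlonglongrightarrow> 1 * (\<bar>1 * sinc \<alpha> - cos \<alpha>\<bar> / mu)"
    unfolding lo_def using mu by (intro tendsto_intros) auto
  then have lo: "lo \<longlonglongrightarrow> 1" using mu unfolding mult_1 \<alpha>(2)[symmetric] by simp
  \<comment> \<open>Once n > \<alpha>, the half-frequency \<alpha>/(2n) lies in (0, 1/2), where sin
    is positive and the cotangent form of the symbol applies.\<close>
  have ev_lo: "eventually (\<lambda>n. lo n \<le> opnorm n / (3 * mu / (real n)\<^sup>2)) sequentially"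
    using eventually_gt_at_top[of "nat \<lceil>\<alpha>\<rceil>"] eventually_gt_at_top[of 0]
  proof eventually_elim
    case (elim n)
    then have "\<alpha> < real n" by linarith
    then have "0 < \<alpha> / real n / 2" "\<alpha> / real n < 1" using elim pos by simp_all
    moreover have "sin (y / 2) > 0" if "0 < y / 2" "y < 1" for y :: real
      using that pi_gt3 by (intro sin_gt_zero) linarith+
    ultimately have s: "sin (\<alpha> / real n / 2) > 0" by blast
    have "12 / (4 * (real n)\<^sup>2 - 1) * \<bar>t n * sinc \<alpha> - cos \<alpha>\<bar> = cmod (E_symbol n (\<alpha> / real n))"
      using elim s by (subst cmod_E_symbol_sinc) (simp_all add: t_def)
    also have "\<dots> \<le> opnorm n" by (rule cmod_E_symbol_le_opnorm)
    also have "12 / (4 * (real n)\<^sup>2 - 1) * \<bar>t n * sinc \<alpha> - cos \<alpha>\<bar> = lo n * (3 * mu / (real n)\<^sup>2)"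
      using elim mu by (simp add: lo_def)
    finally show ?case using elim mu by (subst pos_le_divide_eq) simp_all
  qed
  have ev_hi: "eventually (\<lambda>n. opnorm n / (3 * mu / (real n)\<^sup>2) \<le>
      4 * (real n)\<^sup>2 / (4 * (real n)\<^sup>2 - 1)) sequentially"
    using eventually_gt_at_top[of 0]
  proof eventually_elim
    case (elim n)
    have "opnorm n \<le> 12 * mu / (4 * (real n)\<^sup>2 - 1)" by (rule opnorm_le[OF elim])
    also have "\<dots> = 4 * (real n)\<^sup>2 / (4 * (real n)\<^sup>2 - 1) * (3 * mu / (real n)\<^sup>2)"
      using elim by simp
    finally show ?case using elim mu by (subst pos_divide_le_eq) simp_all
  qed
  \<comment> \<open>The factors \<pi> in the claimed rate cancel to 3 mu / n^2; the quotient by it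
    is squeezed between two sequences tending to 1.\<close>
  have "(\<lambda>n. opnorm n / (3 * mu / (real n)\<^sup>2)) \<longlonglongrightarrow> 1"
    by (rule tendsto_sandwich[OF ev_lo ev_hi lo lim])
  then have "opnorm \<sim>[at_top] (\<lambda>n. (3 * mu / pi) * (pi / (real n)\<^sup>2))"
    by (intro asymp_equivI') simp
  then show ?thesis unfolding opnorm_def .
qed

end
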